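(* Let $n\ge 1$ and let $|\varphi\rangle=\sum_{x\in\{0,1\}^n} a_x|x\rangle$ be an $n$-qubit quantum state with arbitrary complex probability amplitudes $a_x$, normalized so that $\sum_{x\in\{0,1\}^n}|a_x|^2=1$. Then there exists a random tree of depth $n$ whose outcome probabilities coincide with the measurement probabilities of $|\varphi\rangle$; that is, there is an assignment of branching probabilities $p_w\in[0,1]$ to all binary words $w$ of length $0\le |w|\le n-1$ such that for every $x=x_1x_2\cdots x_n\in\{0,1\}^n$, $$\prod_{k=1}^{n} q(x_1\cdots x_{k-1},x_k)=|a_x|^2,$$ where $q(w,0)=p_w$ and $q(w,1)=1-p_w$ (and $x_1\cdots x_{k-1}$ is the empty word when $k=1$).
   Context: A (binary) decision tree of depth $n$ is the complete binary tree whose internal nodes are the binary words $w$ of length $0,1,\dots,n-1$ (the root being the empty word) and whose leaves are the words in $\{0,1\}^n$. The left child of node $w$ is $w0$ and the right child is $w1$. Each internal node $w$ carries a branching probability $p_w\in[0,1]$: from $w$ one moves to $w0$ with probability $p_w$ and to $w1$ with probability $1-p_w$. The probability of an outcome (leaf) $x$ is the product of the branching probabilities along the path from the root to $x$. A random tree is a decision tree in which the branching probabilities may vary across nodes (as opposed to a fixed tree, in which the branching probabilities are the same at every node). For a quantum state $|\varphi\rangle=\sum_x a_x|x\rangle$ written in the computational basis, the probability of the event (measurement outcome) $x$ is $|a_x|^2$. *)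

theory Defs
  imports Complex_Main
begin

(* Binary words are bool lists: False is the letter 0, True is the letter 1.
   The head of the list is the first letter. *)

definition words :: "nat \<Rightarrow> bool list set" where
  "words n = {x. length x = n}"

(* The state is given by its amplitudes a x in the computational basis;
   values of a outside words n are irrelevant. *)

definition measurement_prob :: "(bool list \<Rightarrow> complex) \<Rightarrow> bool list \<Rightarrow> real" where
  "measurement_prob a x = (cmod (a x))\<^sup>2"

definition quantum_state :: "nat \<Rightarrow> (bool list \<Rightarrow> complex) \<Rightarrow> bool" where
  "quantum_state n a \<longleftrightarrow> (\<Sum>x\<in>words n. (cmod (a x))\<^sup>2) = 1"

(* The internal nodes of the tree of depth n are the words of length less than n, and
   p w is the probability of moving from w to its left child w0. The values of p
   may differ from node to node, and those at words of length n or more are irrelevant. *)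

definition random_tree :: "nat \<Rightarrow> (bool list \<Rightarrow> real) \<Rightarrow> bool" where
  "random_tree n p \<longleftrightarrow> (\<forall>w. length w < n \<longrightarrow> 0 \<le> p w \<and> p w \<le> 1)"

definition branch_prob :: "(bool list \<Rightarrow> real) \<Rightarrow> bool list \<Rightarrow> bool \<Rightarrow> real" where
  "branch_prob p w b = (if b then 1 - p w else p w)"

(* Letters are indexed from 0: take k x is the node reached after k steps
   and x ! k is the letter chosen there. *)

definition outcome_prob :: "(bool list \<Rightarrow> real) \<Rightarrow> bool list \<Rightarrow> real" where
  "outcome_prob p x = (\<Prod>k<length x. branch_prob p (take k x) (x ! k))"

end

(* Splitting words by their first letter, the root divides the total weight of a nonnegative
   function on the words in the proportion of the weights of the two halves, and each half is
   treated recursively. Without normalization, the weight of a word is the total weight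
   times the probability of that word; this is the form that passes to the subtrees. *)
theory Submission
  imports Defs
begin

lemma sum_words_Suc:
  fixes f :: "bool list \<Rightarrow> 'a::comm_monoid_add"
  shows "sum f (words (Suc n)) = (\<Sum>x\<in>words n. f (False # x)) + (\<Sum>x\<in>words n. f (True # x))"
proof -
  have fin: "finite (words n)"
    using finite_lists_length_eq[of "UNIV :: bool set" n] by (simp add: words_def)
  have "words (Suc n) = (#) False ` words n \<union> (#) True ` words n"
    by (auto simp: words_def length_Suc_conv image_iff)
  then have "sum f (words (Suc n)) = sum f ((#) False ` words n) + sum f ((#) True ` words n)"
    using fin by (simp only:) (rule sum.union_disjoint, auto)
  then show ?thesis
    by (simp add: sum.reindex)
qed

lemma outcome_prob_Cons:
  "outcome_prob p (b # x) = branch_prob p [] b * outcome_prob (\<lambda>w. p (b # w)) x"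
  by (simp add: outcome_prob_def branch_prob_def prod.lessThan_Suc_shift
      cong: if_cong del: prod.lessThan_Suc)

lemma random_tree_Suc:
  "random_tree (Suc n) p \<longleftrightarrow> 0 \<le> p [] \<and> p [] \<le> 1 \<and> (\<forall>b. random_tree n (\<lambda>w. p (b # w)))"
  unfolding random_tree_def by auto (metis Suc_less_eq length_Cons neq_Nil_conv)+

text \<open>Total weight zero must be allowed, since one half of a state may carry no amplitude at
  all; on such a half any branching works.\<close>

lemma exists_random_tree_weights:
  fixes f :: "bool list \<Rightarrow> real"
  assumes "\<And>x. 0 \<le> f x"
  shows "\<exists>p. random_tree n p \<and> (\<forall>x\<in>words n. sum f (words n) * outcome_prob p x = f x)"
  using assms
proof (induction n arbitrary: f)
  case 0
  then show ?case by (auto simp: random_tree_def words_def outcome_prob_def)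
next
  case (Suc n)
  define S where "S b = (\<Sum>x\<in>words n. f (b # x))" for b
  have S_nonneg: "0 \<le> S b" for b
    unfolding S_def by (simp add: Suc.prems sum_nonneg)
  have "\<forall>b. \<exists>p. random_tree n p \<and> (\<forall>x\<in>words n. S b * outcome_prob p x = f (b # x))"
    using Suc.IH[of "\<lambda>x. f (_ # x)"] Suc.prems unfolding S_def by blast
  then obtain q where q: "random_tree n (q b)"
      "x \<in> words n \<Longrightarrow> S b * outcome_prob (q b) x = f (b # x)" for b x
    by metis
  \<comment> \<open>The root branches in proportion to the weights of the two halves, and the tree
    \<open>q b\<close> is grafted below child \<open>b\<close>.\<close>
  define p where
    "p w = (case w of [] \<Rightarrow> S False / (S False + S True) | b # v \<Rightarrow> q b v)" for w
  \<comment> \<open>If both halves weigh zero, the quotient at the root is 0 by convention, still an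
    admissible probability.\<close>
  have "random_tree (Suc n) p"
    using S_nonneg[of False] S_nonneg[of True] q(1)
    by (auto simp: random_tree_Suc p_def divide_le_eq_1)
  moreover have "sum f (words (Suc n)) * outcome_prob p x = f x" if mem: "x \<in> words (Suc n)" for x
  proof -
    obtain b y where x: "x = b # y" "y \<in> words n"
      using mem by (auto simp: words_def length_Suc_conv)
    \<comment> \<open>If the total weight is zero then so are both parts, and the junk value 0 / 0 does no harm.\<close>
    have "(S False + S True) * branch_prob p [] b = S b"
      using S_nonneg[of False] S_nonneg[of True]
      by (cases "S False + S True = 0"; cases b)
        (auto simp: branch_prob_def p_def field_simps add_nonneg_eq_0_iff)
    then have "(S False + S True) * outcome_prob p x = S b * outcome_prob (q b) y"
      by (simp add: x outcome_prob_Cons p_def mult.assoc[symmetric])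
    then show ?thesis
      using q(2) x by (simp add: sum_words_Suc S_def)
  qed
  ultimately show ?case by blast
qed

theorem theorem1:
  fixes n :: nat and a :: "bool list \<Rightarrow> complex"
  assumes "n \<ge> 1"
    and "quantum_state n a"
  shows "\<exists>p :: bool list \<Rightarrow> real.
    random_tree n p \<and> (\<forall>x\<in>words n. outcome_prob p x = measurement_prob a x)"
  \<comment> \<open>Normalization makes the total weight 1, so the factor in front of
    \<open>outcome_prob\<close> disappears.\<close>
  using exists_random_tree_weights[of "measurement_prob a" n] assms(2)
  by (simp add: quantum_state_def measurement_prob_def)

end
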